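(* Let $k$ be a commutative ring, $G$ a group and $\mathcal{B}$ a $G$-graded category over $k$. Then the categories $(\mathcal{B}\# G)[G]$ and $\mathcal{B}$ are equivalent (as categories over $k$), where $\mathcal{B}\# G$ is the smash product category with the translation action of $G$ and $(\mathcal{B}\# G)[G]$ is its skew category.
   Context: Category over $k$: a small category with object set $\mathcal{B}_0$ such that each morphism set ${}_y\mathcal{B}_x$ (morphisms from $x$ to $y$) is a $k$-module and composition is $k$-bilinear. Equivalences of categories over $k$ are understood to be $k$-linear. $G$-graded category over $k$: a category $\mathcal{B}$ over $k$ with decompositions ${}_y\mathcal{B}_x=\bigoplus_{s\in G}{}_y\mathcal{B}_x^{\,s}$ such that ${}_z\mathcal{B}_y^{\,t}\;{}_y\mathcal{B}_x^{\,s}\subset{}_z\mathcal{B}_x^{\,ts}$ and ${}_x1_x\in{}_x\mathcal{B}_x^{\,1}$. Smash product category $\mathcal{B}\# G$: objects $\mathcal{B}_0\times G$, morphisms ${}_{(y,t)}(\mathcal{B}\# G)_{(x,s)}={}_y\mathcal{B}_x^{\,t^{-1}s}$, composition given by the composition ${}_z\mathcal{B}_y^{\,u^{-1}t}\otimes_k{}_y\mathcal{B}_x^{\,t^{-1}s}\to{}_z\mathcal{B}_x^{\,u^{-1}s}$ of $\mathcal{B}$. The translation action of $G$ is given on objects by $u(x,s)=(x,us)$, and on a morphism $f\in{}_{(y,t)}(\mathcal{B}\# G)_{(x,s)}={}_y\mathcal{B}_x^{\,t^{-1}s}$ by $uf=f\in{}_{(y,ut)}(\mathcal{B}\# G)_{(x,us)}={}_y\mathcal{B}_x^{\,t^{-1}s}$.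 $G$-category over $k$: a category $\mathcal{C}$ over $k$ with an action of $G$ on the set $\mathcal{C}_0$ and $k$-module maps $s:{}_y\mathcal{C}_x\to{}_{sy}\mathcal{C}_{sx}$ such that $s(gf)=(sg)(sf)$ for composable $g,f$, $(ts)f=t(sf)$ and $1f=f$. Skew category $\mathcal{C}[G]$ of a $G$-category $\mathcal{C}$: objects $\mathcal{C}_0$, morphisms ${}_y(\mathcal{C}[G])_x=\bigoplus_{s\in G}{}_y\mathcal{C}_{sx}$ (external direct sum indexed by $s$). For $g$ in the component ${}_z\mathcal{C}_{ty}$ indexed by $t$ and $f$ in the component ${}_y\mathcal{C}_{sx}$ indexed by $s$, the composite is $gf=g\circ(tf)$, in the component ${}_z\mathcal{C}_{tsx}$ indexed by $ts$. *)

theory Defs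
  imports "HOL-Algebra.Module" "HOL-Algebra.Group_Action"
begin

section \<open>Module maps and direct sums of modules\<close>

locale module_map = M?: module R M + N?: module R N
  for R (structure) and M (structure) and N (structure) and h +
  assumes map_closed: "x \<in> carrier M \<Longrightarrow> h x \<in> carrier N"
    and map_add: "\<lbrakk>x \<in> carrier M; y \<in> carrier M\<rbrakk> \<Longrightarrow> h (x \<oplus>\<^bsub>M\<^esub> y) = h x \<oplus>\<^bsub>N\<^esub> h y"
    and map_smult: "\<lbrakk>a \<in> carrier R; x \<in> carrier M\<rbrakk> \<Longrightarrow> h (a \<odot>\<^bsub>M\<^esub> x) = a \<odot>\<^bsub>N\<^esub> h x"

text \<open>External direct sum. The fields \<open>mult\<close> and \<open>one\<close>, which the record of modules inherits
  from that of rings, play no role.\<close>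

definition module_sum :: "'i set \<Rightarrow> ('i \<Rightarrow> ('k, 'm) module) \<Rightarrow> ('k, 'i \<Rightarrow> 'm) module" where
  "module_sum I M =
    \<lparr>carrier = {f \<in> \<Pi>\<^sub>E i\<in>I. carrier (M i). finite {i \<in> I. f i \<noteq> \<zero>\<^bsub>M i\<^esub>}},
     mult = undefined, one = undefined,
     zero = (\<lambda>i\<in>I. \<zero>\<^bsub>M i\<^esub>),
     add = (\<lambda>f g. \<lambda>i\<in>I. f i \<oplus>\<^bsub>M i\<^esub> g i),
     smult = (\<lambda>a f. \<lambda>i\<in>I. a \<odot>\<^bsub>M i\<^esub> f i)\<rparr>"

text \<open>\<open>M\<close> is the internal direct sum of the submodules \<open>N i\<close>. The sum is taken over the
  (finite) support because \<open>finsum\<close> is zero over infinite index sets.\<close>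

definition internal_direct_sum ::
  "('k, 'r) ring_scheme \<Rightarrow> ('k, 'm) module \<Rightarrow> 'i set \<Rightarrow> ('i \<Rightarrow> 'm set) \<Rightarrow> bool" where
  "internal_direct_sum k M I N \<longleftrightarrow>
    (\<forall>i\<in>I. submodule (N i) k M) \<and>
    bij_betw (\<lambda>f. finsum M f {i \<in> I. f i \<noteq> \<zero>\<^bsub>M\<^esub>})
      (carrier (module_sum I (\<lambda>i. M\<lparr>carrier := N i\<rparr>))) (carrier M)"

section \<open>Categories over a commutative ring\<close>

text \<open>\<open>Hom C y x\<close> is the module of morphisms from \<open>x\<close> to \<open>y\<close>, and \<open>Comp C z y x g f\<close> is the
  composite of \<open>f\<close> from \<open>x\<close> to \<open>y\<close> with \<open>g\<close> from \<open>y\<close> to \<open>z\<close>. Operations on morphisms carry the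
  objects as arguments because the modules \<open>Hom C y x\<close> need not be disjoint.\<close>

record ('k, 'o, 'm) lincat =
  Obj :: "'o set"
  Hom :: "'o \<Rightarrow> 'o \<Rightarrow> ('k, 'm) module"
  Comp :: "'o \<Rightarrow> 'o \<Rightarrow> 'o \<Rightarrow> 'm \<Rightarrow> 'm \<Rightarrow> 'm"
  Ident :: "'o \<Rightarrow> 'm"

locale linear_category =
  fixes k :: "('k, 'r) ring_scheme" and C :: "('k, 'o, 'm, 'z) lincat_scheme"
  assumes cring_k: "cring k"
    and Hom_module: "\<lbrakk>x \<in> Obj C; y \<in> Obj C\<rbrakk> \<Longrightarrow> module k (Hom C y x)"
    and Comp_linear_left:
      "\<lbrakk>x \<in> Obj C; y \<in> Obj C; z \<in> Obj C; f \<in> carrier (Hom C y x)\<rbrakk>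
        \<Longrightarrow> module_map k (Hom C z y) (Hom C z x) (\<lambda>g. Comp C z y x g f)"
    and Comp_linear_right:
      "\<lbrakk>x \<in> Obj C; y \<in> Obj C; z \<in> Obj C; g \<in> carrier (Hom C z y)\<rbrakk>
        \<Longrightarrow> module_map k (Hom C y x) (Hom C z x) (\<lambda>f. Comp C z y x g f)"
    and Comp_assoc:
      "\<lbrakk>w \<in> Obj C; x \<in> Obj C; y \<in> Obj C; z \<in> Obj C;
        f \<in> carrier (Hom C x w); g \<in> carrier (Hom C y x); h \<in> carrier (Hom C z y)\<rbrakk>
        \<Longrightarrow> Comp C z y w h (Comp C y x w g f) = Comp C z x w (Comp C z y x h g) f"
    and Ident_closed: "x \<in> Obj C \<Longrightarrow> Ident C x \<in> carrier (Hom C x x)"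
    and Comp_Ident_left:
      "\<lbrakk>x \<in> Obj C; y \<in> Obj C; f \<in> carrier (Hom C y x)\<rbrakk> \<Longrightarrow> Comp C y y x (Ident C y) f = f"
    and Comp_Ident_right:
      "\<lbrakk>x \<in> Obj C; y \<in> Obj C; f \<in> carrier (Hom C y x)\<rbrakk> \<Longrightarrow> Comp C y x x f (Ident C x) = f"

section \<open>Linear equivalence of categories\<close>

text \<open>\<open>FMor F y x\<close> is the action of \<open>F\<close> on the morphisms from \<open>x\<close> to \<open>y\<close>.\<close>

record ('o, 'm, 'p, 'n) cfunctor =
  FObj :: "'o \<Rightarrow> 'p"
  FMor :: "'o \<Rightarrow> 'o \<Rightarrow> 'm \<Rightarrow> 'n"

definition id_functor :: "('o, 'm, 'o, 'm) cfunctor" where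
  "id_functor = \<lparr>FObj = (\<lambda>x. x), FMor = (\<lambda>y x f. f)\<rparr>"

definition comp_functor ::
  "('p, 'n, 'q, 'l) cfunctor \<Rightarrow> ('o, 'm, 'p, 'n) cfunctor \<Rightarrow> ('o, 'm, 'q, 'l) cfunctor" where
  "comp_functor F' F =
    \<lparr>FObj = (\<lambda>x. FObj F' (FObj F x)),
     FMor = (\<lambda>y x f. FMor F' (FObj F y) (FObj F x) (FMor F y x f))\<rparr>"

locale linear_functor = A?: linear_category k A + B?: linear_category k B
  for k :: "('k, 'r) ring_scheme"
    and A :: "('k, 'o, 'm, 'z) lincat_scheme"
    and B :: "('k, 'p, 'n, 'w) lincat_scheme"
    and F :: "('o, 'm, 'p, 'n) cfunctor" +
  assumes FObj_closed: "x \<in> Obj A \<Longrightarrow> FObj F x \<in> Obj B"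
    and FMor_linear:
      "\<lbrakk>x \<in> Obj A; y \<in> Obj A\<rbrakk>
        \<Longrightarrow> module_map k (Hom A y x) (Hom B (FObj F y) (FObj F x)) (FMor F y x)"
    and FMor_Comp:
      "\<lbrakk>x \<in> Obj A; y \<in> Obj A; z \<in> Obj A; f \<in> carrier (Hom A y x); g \<in> carrier (Hom A z y)\<rbrakk>
        \<Longrightarrow> FMor F z x (Comp A z y x g f) =
            Comp B (FObj F z) (FObj F y) (FObj F x) (FMor F z y g) (FMor F y x f)"
    and FMor_Ident: "x \<in> Obj A \<Longrightarrow> FMor F x x (Ident A x) = Ident B (FObj F x)"

definition iso_morphism :: "('k, 'o, 'm, 'z) lincat_scheme \<Rightarrow> 'o \<Rightarrow> 'o \<Rightarrow> 'm \<Rightarrow> bool" where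
  "iso_morphism C y x f \<longleftrightarrow>
    f \<in> carrier (Hom C y x) \<and>
    (\<exists>g \<in> carrier (Hom C x y). Comp C x y x g f = Ident C x \<and> Comp C y x y f g = Ident C y)"

definition natural_iso ::
  "('k, 'o, 'm, 'z) lincat_scheme \<Rightarrow> ('k, 'p, 'n, 'w) lincat_scheme \<Rightarrow>
    ('o, 'm, 'p, 'n) cfunctor \<Rightarrow> ('o, 'm, 'p, 'n) cfunctor \<Rightarrow> ('o \<Rightarrow> 'n) \<Rightarrow> bool" where
  "natural_iso A B F F' \<eta> \<longleftrightarrow>
    (\<forall>x\<in>Obj A. iso_morphism B (FObj F' x) (FObj F x) (\<eta> x)) \<and>
    (\<forall>x\<in>Obj A. \<forall>y\<in>Obj A. \<forall>f\<in>carrier (Hom A y x).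
      Comp B (FObj F' y) (FObj F y) (FObj F x) (\<eta> y) (FMor F y x f) =
      Comp B (FObj F' y) (FObj F' x) (FObj F x) (FMor F' y x f) (\<eta> x))"

definition linearly_equivalent ::
  "('k, 'r) ring_scheme \<Rightarrow> ('k, 'o, 'm, 'z) lincat_scheme \<Rightarrow> ('k, 'p, 'n, 'w) lincat_scheme
    \<Rightarrow> bool" where
  "linearly_equivalent k A B \<longleftrightarrow>
    (\<exists>F F' \<eta> \<epsilon>. linear_functor k A B F \<and> linear_functor k B A F' \<and>
      natural_iso A A (comp_functor F' F) id_functor \<eta> \<and>
      natural_iso B B (comp_functor F F') id_functor \<epsilon>)"

section \<open>Graded categories\<close>

text \<open>\<open>Deg B y x s\<close> is the homogeneous component of degree \<open>s\<close> of \<open>Hom B y x\<close>.\<close>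

record ('k, 'o, 'm, 'g) graded_lincat = "('k, 'o, 'm) lincat" +
  Deg :: "'o \<Rightarrow> 'o \<Rightarrow> 'g \<Rightarrow> 'm set"

locale graded_category = linear_category k B + group G
  for k :: "('k, 'r) ring_scheme"
    and G :: "('g, 'h) monoid_scheme" (structure)
    and B :: "('k, 'o, 'm, 'g, 'z) graded_lincat_scheme" +
  assumes Deg_direct_sum:
      "\<lbrakk>x \<in> Obj B; y \<in> Obj B\<rbrakk> \<Longrightarrow> internal_direct_sum k (Hom B y x) (carrier G) (Deg B y x)"
    and Deg_Comp:
      "\<lbrakk>x \<in> Obj B; y \<in> Obj B; z \<in> Obj B; s \<in> carrier G; t \<in> carrier G;
        f \<in> Deg B y x s; g \<in> Deg B z y t\<rbrakk>
        \<Longrightarrow> Comp B z y x g f \<in> Deg B z x (t \<otimes> s)"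
    and Deg_Ident: "x \<in> Obj B \<Longrightarrow> Ident B x \<in> Deg B x x \<one>"

section \<open>Categories with a group action and their skew categories\<close>

text \<open>\<open>ActMor C s y x\<close> is the action of \<open>s\<close> on the morphisms from \<open>x\<close> to \<open>y\<close>.\<close>

record ('k, 'o, 'm, 'g) action_lincat = "('k, 'o, 'm) lincat" +
  ActObj :: "'g \<Rightarrow> 'o \<Rightarrow> 'o"
  ActMor :: "'g \<Rightarrow> 'o \<Rightarrow> 'o \<Rightarrow> 'm \<Rightarrow> 'm"

locale G_category = linear_category k C + group G + group_action G "Obj C" "ActObj C"
  for k :: "('k, 'r) ring_scheme"
    and G :: "('g, 'h) monoid_scheme"
    and C :: "('k, 'o, 'm, 'g, 'z) action_lincat_scheme" +
  assumes ActMor_linear: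
      "\<lbrakk>s \<in> carrier G; x \<in> Obj C; y \<in> Obj C\<rbrakk>
        \<Longrightarrow> module_map k (Hom C y x) (Hom C (ActObj C s y) (ActObj C s x)) (ActMor C s y x)"
    and ActMor_Comp:
      "\<lbrakk>s \<in> carrier G; x \<in> Obj C; y \<in> Obj C; z \<in> Obj C;
        f \<in> carrier (Hom C y x); g \<in> carrier (Hom C z y)\<rbrakk>
        \<Longrightarrow> ActMor C s z x (Comp C z y x g f) =
            Comp C (ActObj C s z) (ActObj C s y) (ActObj C s x) (ActMor C s z y g) (ActMor C s y x f)"
    and ActMor_mult:
      "\<lbrakk>s \<in> carrier G; t \<in> carrier G; x \<in> Obj C; y \<in> Obj C; f \<in> carrier (Hom C y x)\<rbrakk>
        \<Longrightarrow> ActMor C (t \<otimes>\<^bsub>G\<^esub> s) y x f =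
            ActMor C t (ActObj C s y) (ActObj C s x) (ActMor C s y x f)"
    and ActMor_one:
      "\<lbrakk>x \<in> Obj C; y \<in> Obj C; f \<in> carrier (Hom C y x)\<rbrakk> \<Longrightarrow> ActMor C \<one>\<^bsub>G\<^esub> y x f = f"

text \<open>The composition extends \<open>g f = g \<circ> (t f)\<close>, for \<open>g\<close> in the component indexed by \<open>t\<close> and \<open>f\<close>
  in the one indexed by \<open>s\<close>, bilinearly; the result lies in the component indexed by \<open>t s\<close>.\<close>

definition skew_category ::
  "('g, 'h) monoid_scheme \<Rightarrow> ('k, 'o, 'm, 'g, 'z) action_lincat_scheme
    \<Rightarrow> ('k, 'o, 'g \<Rightarrow> 'm) lincat" where
  "skew_category G C =
    \<lparr>Obj = Obj C,
     Hom = (\<lambda>y x. module_sum (carrier G) (\<lambda>s. Hom C y (ActObj C s x))),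
     Comp = (\<lambda>z y x g f. \<lambda>u\<in>carrier G.
       finsum (Hom C z (ActObj C u x))
         (\<lambda>(t, s). Comp C z (ActObj C t y) (ActObj C u x)
            (g t) (ActMor C t y (ActObj C s x) (f s)))
         {(t, s). t \<in> carrier G \<and> s \<in> carrier G \<and> t \<otimes>\<^bsub>G\<^esub> s = u \<and>
            g t \<noteq> \<zero>\<^bsub>Hom C z (ActObj C t y)\<^esub> \<and> f s \<noteq> \<zero>\<^bsub>Hom C y (ActObj C s x)\<^esub>}),
     Ident = (\<lambda>x. \<lambda>s\<in>carrier G. if s = \<one>\<^bsub>G\<^esub> then Ident C x else \<zero>\<^bsub>Hom C x (ActObj C s x)\<^esub>)\<rparr>"

section \<open>The smash product with its translation action\<close>

definition smash_product ::
  "('g, 'h) monoid_scheme \<Rightarrow> ('k, 'o, 'm, 'g, 'z) graded_lincat_scheme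
    \<Rightarrow> ('k, 'o \<times> 'g, 'm, 'g) action_lincat" where
  "smash_product G B =
    \<lparr>Obj = Obj B \<times> carrier G,
     Hom = (\<lambda>(y, t) (x, s). (Hom B y x)\<lparr>carrier := Deg B y x (inv\<^bsub>G\<^esub> t \<otimes>\<^bsub>G\<^esub> s)\<rparr>),
     Comp = (\<lambda>(z, u) (y, t) (x, s) g f. Comp B z y x g f),
     Ident = (\<lambda>(x, s). Ident B x),
     ActObj = (\<lambda>u. \<lambda>(x, s)\<in>Obj B \<times> carrier G. (x, u \<otimes>\<^bsub>G\<^esub> s)),
     ActMor = (\<lambda>u y x f. f)\<rparr>"


lemma (in graded_category) Deg_submodule:
  "\<lbrakk>x \<in> Obj B; y \<in> Obj B; s \<in> carrier G\<rbrakk> \<Longrightarrow> submodule (Deg B y x s) k (Hom B y x)"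
  using Deg_direct_sum by (simp add: internal_direct_sum_def)

lemma (in graded_category) Deg_subset:
  "\<lbrakk>x \<in> Obj B; y \<in> Obj B; s \<in> carrier G\<rbrakk> \<Longrightarrow> Deg B y x s \<subseteq> carrier (Hom B y x)"
  using Hom_module Deg_submodule by (meson module.submoduleE(1))

lemma (in graded_category) Deg_module:
  "\<lbrakk>x \<in> Obj B; y \<in> Obj B; s \<in> carrier G\<rbrakk>
    \<Longrightarrow> module k ((Hom B y x)\<lparr>carrier := Deg B y x s\<rparr>)"
  by (rule submodule.submodule_is_module[OF Deg_submodule Hom_module])

lemma (in graded_category) smash_product_linear_category:
  "linear_category k (smash_product G B)"
proof -
  have inv_mult: "(inv u \<otimes> t) \<otimes> (inv t \<otimes> s) = inv u \<otimes> s"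
    if "s \<in> carrier G" "t \<in> carrier G" "u \<in> carrier G" for s t u
    using that by (metis inv_closed m_assoc m_closed r_inv r_one)
  have comp: "Comp B z y x g f \<in> Deg B z x (inv u \<otimes> s)"
    if "x \<in> Obj B" "y \<in> Obj B" "z \<in> Obj B" "s \<in> carrier G" "t \<in> carrier G" "u \<in> carrier G"
      "f \<in> Deg B y x (inv t \<otimes> s)" "g \<in> Deg B z y (inv u \<otimes> t)" for x y z s t u f g
    using Deg_Comp[of x y z "inv t \<otimes> s" "inv u \<otimes> t" f g] inv_mult that by simp
  have sub: "f \<in> carrier (Hom B y x)"
    if "x \<in> Obj B" "y \<in> Obj B" "s \<in> carrier G" "t \<in> carrier G" "f \<in> Deg B y x (inv t \<otimes> s)"
    for x y s t f
    using Deg_subset[of x y "inv t \<otimes> s"] that by auto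
  show ?thesis
  proof (rule linear_category.intro, goal_cases)
    case 1
    show ?case by (rule cring_k)
  next
    case (2 x y)
    then show ?case by (auto simp: smash_product_def intro!: Deg_module)
  next
    case (3 x y z f)
    then show ?case
      apply (clarsimp simp: smash_product_def)
      apply (intro module_map.intro module_map_axioms.intro)
      apply (auto intro!: Deg_module intro: comp sub
          module_map.map_add[OF Comp_linear_left] module_map.map_smult[OF Comp_linear_left])
      done
  next
    case (4 x y z g)
    then show ?case
      apply (clarsimp simp: smash_product_def)
      apply (intro module_map.intro module_map_axioms.intro)
      apply (auto intro!: Deg_module intro: comp sub
          module_map.map_add[OF Comp_linear_right] module_map.map_smult[OF Comp_linear_right])
      done
  next
    case (5 w x y z f g h)
    then show ?case
      apply (clarsimp simp: smash_product_def)
      apply (rule Comp_assoc)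
            apply (assumption | erule sub[rotated 4])+
      done
  next
    case (6 x)
    then show ?case by (auto simp: smash_product_def Deg_Ident)
  next
    case (7 x y f)
    then show ?case
      apply (clarsimp simp: smash_product_def)
      apply (rule Comp_Ident_left)
        apply (assumption | erule sub[rotated 4])+
      done
  next
    case (8 x y f)
    then show ?case
      apply (clarsimp simp: smash_product_def)
      apply (rule Comp_Ident_right)
        apply (assumption | erule sub[rotated 4])+
      done
  qed
qed

lemma (in group) translation_action:
  "group_action G (X \<times> carrier G) (\<lambda>u. \<lambda>(x, s)\<in>X \<times> carrier G. (x, u \<otimes> s))"
  (is "group_action G ?E ?\<phi>")
proof -
  have bij: "?\<phi> u \<in> Bij ?E" if u: "u \<in> carrier G" for u
  proof -
    have "bij_betw (?\<phi> u) ?E ?E"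
      by (rule bij_betw_byWitness[where f' = "?\<phi> (inv u)"])
        (use u in \<open>auto simp: m_assoc[symmetric]\<close>)
    then show ?thesis by (simp add: Bij_def)
  qed
  have "?\<phi> (u \<otimes> v) = compose ?E (?\<phi> u) (?\<phi> v)"
    if "u \<in> carrier G" "v \<in> carrier G" for u v
    using that by (auto simp: compose_def fun_eq_iff m_assoc)
  then have "?\<phi> \<in> hom G (BijGroup ?E)"
    using bij by (auto simp: hom_def BijGroup_def)
  then show ?thesis
    by (simp add: group_action_def group_hom_def group_hom_axioms_def group_BijGroup is_group)
qed

theorem (in graded_category) smash_product_G_category:
  "G_category k G (smash_product G B)"
proof -
  have inv_mult: "inv (u \<otimes> t) \<otimes> (u \<otimes> s) = inv t \<otimes> s"
    if "s \<in> carrier G" "t \<in> carrier G" "u \<in> carrier G" for s t u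
    using that by (metis inv_closed inv_mult_group inv_solve_left m_assoc m_closed)
  interpret S: linear_category k "smash_product G B"
    by (rule smash_product_linear_category)
  have "group_action G (Obj (smash_product G B)) (ActObj (smash_product G B))"
    using translation_action by (simp add: smash_product_def)
  moreover have "G_category_axioms k G (smash_product G B)"
  proof (rule G_category_axioms.intro, goal_cases)
    case (1 s x y)
    then show ?case
      apply (clarsimp simp: smash_product_def inv_mult)
      apply (intro module_map.intro module_map_axioms.intro)
      apply (auto intro!: Deg_module)
      done
  qed (auto simp: smash_product_def)
  ultimately show ?thesis
    by (simp add: G_category_def S.linear_category_axioms is_group)
qed

end

theory Submission
  imports Defs
begin

text \<open>The morphisms from \<open>(x, s)\<close> to \<open>(y, t)\<close> in the skew category are families indexed by \<open>u\<close> of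
  morphisms of \<open>B\<close> from \<open>x\<close> to \<open>y\<close> of degree \<open>t\<inverse>us\<close>. Since \<open>u \<mapsto> t\<inverse>us\<close> permutes \<open>G\<close>, the grading says
  that summing a family is an isomorphism onto all morphisms from \<open>x\<close> to \<open>y\<close>. Summation respects
  composition and identities, so it is a fully faithful functor over \<open>(x, s) \<mapsto> x\<close>, which is
  surjective on objects. The category axioms of the skew category are pulled back along it.\<close>

section \<open>Finite sums\<close>

context abelian_monoid
begin

text \<open>The fibres of \<open>h\<close> over \<open>T\<close> partition \<open>P\<close>. With
  multiplication in the group as \<open>h\<close>, this reassembles the components of a composite in
  the skew category into one sum over pairs of indices.\<close>

lemma finsum_fibres:
  assumes "finite P" "finite T" "h ` P \<subseteq> T" "c \<in> P \<rightarrow> carrier G"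
  shows "finsum G (\<lambda>u. finsum G c {p \<in> P. h p = u}) T = finsum G c P"
proof -
  have "finsum G c (\<Union>u\<in>T. {p \<in> P. h p = u}) = finsum G (\<lambda>u. finsum G c {p \<in> P. h p = u}) T"
    by (rule add.finprod_UN_disjoint) (use assms in \<open>auto simp: pairwise_def disjnt_def\<close>)
  moreover have "(\<Union>u\<in>T. {p \<in> P. h p = u}) = P"
    using assms by auto
  ultimately show ?thesis by simp
qed

text \<open>The product is cut into disjoint slices, one for each \<open>a\<close>. The iterated
  form is the one from which a bilinear composition can be pulled out, one variable at a
  time.\<close>

lemma finsum_Times:
  assumes "finite A" "finite B" "c \<in> A \<times> B \<rightarrow> carrier G"
  shows "finsum G c (A \<times> B) = finsum G (\<lambda>a. finsum G (\<lambda>b. c (a, b)) B) A"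
proof -
  have "finsum G c (\<Union>a\<in>A. Pair a ` B) = finsum G (\<lambda>a. finsum G c (Pair a ` B)) A"
    by (rule add.finprod_UN_disjoint) (use assms in \<open>auto simp: pairwise_def disjnt_def\<close>)
  also have "\<dots> = finsum G (\<lambda>a. finsum G (\<lambda>b. c (a, b)) B) A"
  proof (rule finsum_cong'[OF refl])
    show "(\<lambda>a. finsum G (\<lambda>b. c (a, b)) B) \<in> A \<rightarrow> carrier G"
      using assms(3) by (auto intro!: finsum_closed)
    show "finsum G c (Pair a ` B) = finsum G (\<lambda>b. c (a, b)) B" if "a \<in> A" for a
      by (rule finsum_reindex) (use assms(3) that in \<open>auto simp: inj_on_def\<close>)
  qed
  also have "(\<Union>a\<in>A. Pair a ` B) = A \<times> B"
    by auto
  finally show ?thesis .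
qed

text \<open>Supports vary with the family and may shrink under addition; padding with zero terms
  allows sums of different families to be compared over a common finite set.\<close>

lemma finsum_support_superset:
  assumes "finite T" "{i \<in> I. f i \<noteq> \<zero>} \<subseteq> T" "T \<subseteq> I" "f \<in> I \<rightarrow> carrier G"
  shows "finsum G f {i \<in> I. f i \<noteq> \<zero>} = finsum G f T"
  by (rule add.finprod_mono_neutral_cong_left) (use assms in auto)

end

section \<open>Module maps\<close>

context module_map
begin

lemma map_zero: "h \<zero>\<^bsub>M\<^esub> = \<zero>\<^bsub>N\<^esub>"
  using map_smult[of "\<zero>\<^bsub>R\<^esub>" "\<zero>\<^bsub>M\<^esub>"] map_closed[of "\<zero>\<^bsub>M\<^esub>"]
  by (simp add: M.smult_l_null N.smult_l_null)

text \<open>Additivity handles finite \<open>A\<close> by induction. For infinite \<open>A\<close>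
  both sums are zero by convention, and \<open>h\<close> preserves zero.\<close>

lemma map_finsum:
  "f \<in> A \<rightarrow> carrier M \<Longrightarrow> h (finsum M f A) = finsum N (\<lambda>i. h (f i)) A"
proof (induction A rule: infinite_finite_induct)
  case (insert a A)
  then show ?case
    by (simp add: M.M.finsum_insert N.M.finsum_insert Pi_def map_add map_closed M.M.finsum_closed)
qed (simp_all add: map_zero M.M.finsum_infinite N.M.finsum_infinite)

text \<open>Both sides of each linearity equation have the same image under \<open>h\<close>, so
  injectivity identifies them. This makes the inverse functor linear on morphisms.\<close>

lemma inv_into_module_map:
  assumes bij: "bij_betw h (carrier M) (carrier N)"
  shows "module_map R N M (inv_into (carrier M) h)"
proof -
  let ?g = "inv_into (carrier M) h"
  have g: "?g y \<in> carrier M" "h (?g y) = y" if "y \<in> carrier N" for y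
    using bij that by (auto simp: bij_betw_def inv_into_into f_inv_into_f)
  have eq: "?g y = x" if "x \<in> carrier M" "h x = y" for x y
    using bij that by (auto simp: bij_betw_def)
  show ?thesis
  proof (intro module_map.intro module_map_axioms.intro)
    show "module R N" "module R M" by unfold_locales
    show "?g y \<in> carrier M" if "y \<in> carrier N" for y
      by (rule g[OF that])
    show "?g (y \<oplus>\<^bsub>N\<^esub> z) = ?g y \<oplus>\<^bsub>M\<^esub> ?g z" if "y \<in> carrier N" "z \<in> carrier N" for y z
      by (rule eq) (simp_all add: g that map_add)
    show "?g (a \<odot>\<^bsub>N\<^esub> y) = a \<odot>\<^bsub>M\<^esub> ?g y" if "a \<in> carrier R" "y \<in> carrier N" for a y
      by (rule eq) (simp_all add: g that map_smult)
  qed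
qed

end

text \<open>A sum formed in the restricted module and one formed in \<open>M\<close> are different
  \<open>finsum\<close> terms; with this inclusion \<open>map_finsum\<close> equates them.\<close>

lemma submodule_inclusion:
  assumes "module R M" "submodule N R M"
  shows "module_map R (M\<lparr>carrier := N\<rparr>) M (\<lambda>x. x)"
  using assms submodule.submodule_is_module[OF assms(2,1)] module.submoduleE(1)[OF assms]
  by (auto intro!: module_map.intro module_map_axioms.intro)

section \<open>Direct sums\<close>

lemma module_sum_cong:
  "I = J \<Longrightarrow> (\<And>i. i \<in> J \<Longrightarrow> M i = N i) \<Longrightarrow> module_sum I M = module_sum J N"
  by (auto simp: module_sum_def PiE_def Pi_def restrict_def fun_eq_iff cong: conj_cong)

lemma module_sum_module:
  assumes R: "cring R" and M: "\<And>i. i \<in> I \<Longrightarrow> module R (M i)"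
  shows "module R (module_sum I M)"
proof -
  have ab: "abelian_group (M i)" if "i \<in> I" for i
    using M[OF that] by (simp add: module_def)
  note abm = abelian_group.axioms(1)[OF ab]
  have cl: "f i \<in> carrier (M i)" if "f \<in> carrier (module_sum I M)" "i \<in> I" for f i
    using that by (auto simp: module_sum_def)
  have fin: "finite {i \<in> I. f i \<noteq> \<zero>\<^bsub>M i\<^esub>}" if "f \<in> carrier (module_sum I M)" for f
    using that by (auto simp: module_sum_def)
  \<comment> \<open>A finite set enclosing the support suffices for membership, so possible
    cancellation need not be tracked.\<close>
  have restrict_mem: "restrict f I \<in> carrier (module_sum I M)"
    if "\<And>i. i \<in> I \<Longrightarrow> f i \<in> carrier (M i)" "{i \<in> I. f i \<noteq> \<zero>\<^bsub>M i\<^esub>} \<subseteq> T" "finite T" for f T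
  proof -
    have "{i \<in> I. restrict f I i \<noteq> \<zero>\<^bsub>M i\<^esub>} = {i \<in> I. f i \<noteq> \<zero>\<^bsub>M i\<^esub>}"
      by auto
    then show ?thesis
      using that finite_subset[OF that(2,3)] by (auto simp: module_sum_def)
  qed
  note [simp] = abelian_groupE[OF ab] module.smult_closed[OF M]
  note cr = cring.cring_simprules[OF R]
  have ext: "f = g" if "f \<in> carrier (module_sum I M)" "g \<in> carrier (module_sum I M)"
    "\<And>i. i \<in> I \<Longrightarrow> f i = g i" for f g
    using that by (auto simp: module_sum_def intro: PiE_ext)
  have ev: "(f \<oplus>\<^bsub>module_sum I M\<^esub> g) i = f i \<oplus>\<^bsub>M i\<^esub> g i"
     "(a \<odot>\<^bsub>module_sum I M\<^esub> f) i = a \<odot>\<^bsub>M i\<^esub> f i"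
     "\<zero>\<^bsub>module_sum I M\<^esub> i = \<zero>\<^bsub>M i\<^esub>" if "i \<in> I" for f g a i
    using that by (auto simp: module_sum_def)
  have zero: "\<zero>\<^bsub>module_sum I M\<^esub> \<in> carrier (module_sum I M)"
    by (auto simp: module_sum_def)
  have add: "f \<oplus>\<^bsub>module_sum I M\<^esub> g \<in> carrier (module_sum I M)"
    if "f \<in> carrier (module_sum I M)" "g \<in> carrier (module_sum I M)" for f g
  proof -
    have "(\<lambda>i\<in>I. f i \<oplus>\<^bsub>M i\<^esub> g i) \<in> carrier (module_sum I M)"
      by (rule restrict_mem[where T = "{i \<in> I. f i \<noteq> \<zero>\<^bsub>M i\<^esub>} \<union> {i \<in> I. g i \<noteq> \<zero>\<^bsub>M i\<^esub>}"])
        (auto simp: cl fin that)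
    then show ?thesis by (simp add: module_sum_def)
  qed
  have smult: "a \<odot>\<^bsub>module_sum I M\<^esub> f \<in> carrier (module_sum I M)"
    if "a \<in> carrier R" "f \<in> carrier (module_sum I M)" for a f
  proof -
    have "(\<lambda>i\<in>I. a \<odot>\<^bsub>M i\<^esub> f i) \<in> carrier (module_sum I M)"
      by (rule restrict_mem[where T = "{i \<in> I. f i \<noteq> \<zero>\<^bsub>M i\<^esub>}"])
        (auto simp: cl fin that module.smult_r_null[OF M])
    then show ?thesis by (simp add: module_sum_def)
  qed
  have neg: "\<exists>g\<in>carrier (module_sum I M). g \<oplus>\<^bsub>module_sum I M\<^esub> f = \<zero>\<^bsub>module_sum I M\<^esub>"
    if "f \<in> carrier (module_sum I M)" for f
  proof (rule bexI)
    \<comment> \<open>Taking the negative as a multiple by -1 reduces its membership to closure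
      under scalars.\<close>
    let ?g = "(\<ominus>\<^bsub>R\<^esub> \<one>\<^bsub>R\<^esub>) \<odot>\<^bsub>module_sum I M\<^esub> f"
    show g: "?g \<in> carrier (module_sum I M)"
      by (simp add: smult that cr)
    show "?g \<oplus>\<^bsub>module_sum I M\<^esub> f = \<zero>\<^bsub>module_sum I M\<^esub>"
      by (rule ext) (auto simp: add g that zero ev cl cr module.smult_l_minus[OF M] module.smult_one[OF M]
        abelian_group.l_neg[OF ab])
  qed
  show ?thesis
  proof (rule moduleI)
    show "abelian_group (module_sum I M)"
      by (rule abelian_groupI) (auto simp: add zero neg ev cl abelian_monoid.a_lcomm[OF abm] abelian_monoid.r_zero[OF abm]
          intro!: ext)
  qed (auto simp: R add smult ev cl module.smult_l_distr[OF M] module.smult_r_distr[OF M]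
      module.smult_assoc1[OF M] module.smult_one[OF M] cr intro!: ext)
qed

text \<open>Precomposition with \<open>h\<close> is a bijection between the two external sums and
  leaves the total of a family unchanged, so one summation map is bijective exactly when the other
  is.\<close>

lemma internal_direct_sum_reindex:
  assumes M: "module R M" and N: "internal_direct_sum R M I N" and h: "bij_betw h J I"
  shows "internal_direct_sum R M J (\<lambda>j. N (h j))"
proof -
  interpret M: module R M by (rule M)
  let ?I = "carrier (module_sum I (\<lambda>i. M\<lparr>carrier := N i\<rparr>))"
  let ?J = "carrier (module_sum J (\<lambda>j. M\<lparr>carrier := N (h j)\<rparr>))"
  let ?\<sigma> = "\<lambda>I f. finsum M f {i \<in> I. f i \<noteq> \<zero>\<^bsub>M\<^esub>}"
  let ?\<rho> = "\<lambda>f. \<lambda>j\<in>J. f (h j)"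
  let ?\<rho>' = "\<lambda>g. \<lambda>i\<in>I. g (inv_into J h i)"
  note hJ = bij_betwE[OF h]
  note h' = bij_betwE[OF bij_betw_inv_into[OF h]] bij_betw_inv_into_left[OF h]
    bij_betw_inv_into_right[OF h]
  have finJ: "finite {j \<in> J. f (h j) \<noteq> \<zero>\<^bsub>M\<^esub>} \<longleftrightarrow> finite {i \<in> I. f i \<noteq> \<zero>\<^bsub>M\<^esub>}"
    and sumJ: "f \<in> ?I \<Longrightarrow> ?\<sigma> J (?\<rho> f) = ?\<sigma> I f" for f
  proof -
    have b: "bij_betw h {j \<in> J. f (h j) \<noteq> \<zero>\<^bsub>M\<^esub>} {i \<in> I. f i \<noteq> \<zero>\<^bsub>M\<^esub>}"
      by (rule bij_betw_subset[OF h]) (use h in \<open>auto simp: bij_betw_def\<close>)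
    then show "finite {j \<in> J. f (h j) \<noteq> \<zero>\<^bsub>M\<^esub>} \<longleftrightarrow> finite {i \<in> I. f i \<noteq> \<zero>\<^bsub>M\<^esub>}"
      by (rule bij_betw_finite)
    assume f: "f \<in> ?I"
    have fM: "f i \<in> carrier M" if "i \<in> I" for i
      using f that N module.submoduleE(1)[OF M] by (fastforce simp: module_sum_def internal_direct_sum_def)
    have "?\<sigma> I f = finsum M f (h ` {j \<in> J. f (h j) \<noteq> \<zero>\<^bsub>M\<^esub>})"
      using b by (simp add: bij_betw_def)
    also have "\<dots> = finsum M (\<lambda>j. f (h j)) {j \<in> J. f (h j) \<noteq> \<zero>\<^bsub>M\<^esub>}"
      by (rule M.finsum_reindex) (use b fM hJ in \<open>auto simp: bij_betw_def\<close>)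
    also have "\<dots> = ?\<sigma> J (?\<rho> f)"
      by (rule M.finsum_cong') (use fM hJ in auto)
    finally show "?\<sigma> J (?\<rho> f) = ?\<sigma> I f" by simp
  qed
  have \<rho>: "bij_betw ?\<rho> ?I ?J"
  proof (rule bij_betw_byWitness[where f' = ?\<rho>'])
    show "\<forall>f\<in>?I. ?\<rho>' (?\<rho> f) = f" "\<forall>g\<in>?J. ?\<rho> (?\<rho>' g) = g"
      using hJ h' by (auto simp: module_sum_def fun_eq_iff restrict_def PiE_def extensional_def)
    have "?\<rho> f \<in> ?J" if "f \<in> ?I" for f
      using that hJ finJ[of f] by (auto simp: module_sum_def cong: conj_cong)
    then show "?\<rho> ` ?I \<subseteq> ?J" by auto
    have "?\<rho>' g \<in> ?I" if g: "g \<in> ?J" for g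
    proof -
      have "finite {j \<in> J. ?\<rho>' g (h j) \<noteq> \<zero>\<^bsub>M\<^esub>}"
        using g hJ h' by (simp add: module_sum_def cong: conj_cong)
      then have "finite {i \<in> I. ?\<rho>' g i \<noteq> \<zero>\<^bsub>M\<^esub>}"
        using finJ[of "?\<rho>' g"] by simp
      moreover have "?\<rho>' g \<in> (\<Pi>\<^sub>E i\<in>I. N i)"
      proof (rule restrict_PiE_iff[THEN iffD2], rule ballI)
        fix i assume "i \<in> I"
        then have "g (inv_into J h i) \<in> N (h (inv_into J h i))"
          using g h'(1) by (auto simp: module_sum_def)
        then show "g (inv_into J h i) \<in> N i"
          using h'(3) \<open>i \<in> I\<close> by simp
      qed
      ultimately show ?thesis by (simp add: module_sum_def)
    qed
    then show "?\<rho>' ` ?J \<subseteq> ?I" by auto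
  qed
  \<comment> \<open>On \<open>?I\<close> this composite is \<open>?\<sigma> I\<close>, bijective by
    hypothesis; cancelling the bijection \<open>?\<rho>\<close> leaves the claim for
    \<open>J\<close>.\<close>
  have "bij_betw (?\<sigma> J \<circ> ?\<rho>) ?I (carrier M)"
    using N sumJ by (simp add: internal_direct_sum_def cong: bij_betw_cong)
  then have "bij_betw (?\<sigma> J) ?J (carrier M)"
    using bij_betw_comp_iff[OF \<rho>] by blast
  then show ?thesis
    using N hJ by (auto simp: internal_direct_sum_def)
qed

text \<open>\<open>internal_direct_sum\<close> demands only that summation be bijective. Its
  linearity is supplied here, by moving all sums to a common finite index set.\<close>

lemma internal_direct_sum_module_map:
  assumes M: "module R M" and N: "internal_direct_sum R M I N"
  shows "module_map R (module_sum I (\<lambda>i. M\<lparr>carrier := N i\<rparr>)) M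
    (\<lambda>f. finsum M f {i \<in> I. f i \<noteq> \<zero>\<^bsub>M\<^esub>})"
proof -
  interpret M: module R M by (rule M)
  let ?S = "module_sum I (\<lambda>i. M\<lparr>carrier := N i\<rparr>)"
  let ?supp = "\<lambda>f. {i \<in> I. f i \<noteq> \<zero>\<^bsub>M\<^esub>}"
  have sub: "submodule (N i) R M" if "i \<in> I" for i
    using N that by (simp add: internal_direct_sum_def)
  have S: "module R ?S"
    by (rule module_sum_module[OF module.axioms(1)[OF M] submodule.submodule_is_module[OF sub M]])
  have cl: "f i \<in> carrier M" if "f \<in> carrier ?S" "i \<in> I" for f i
    using that module.submoduleE(1)[OF M sub] by (auto simp: module_sum_def)
  have finI: "finite (?supp f)" if "f \<in> carrier ?S" for f
    using that by (auto simp: module_sum_def)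
  have ev: "(f \<oplus>\<^bsub>?S\<^esub> g) i = f i \<oplus>\<^bsub>M\<^esub> g i" "(a \<odot>\<^bsub>?S\<^esub> f) i = a \<odot>\<^bsub>M\<^esub> f i"
    if "i \<in> I" for f g a i
    using that by (auto simp: module_sum_def)
  have sum_eq: "finsum M f (?supp f) = finsum M f T"
    if "f \<in> I \<rightarrow> carrier M" "?supp f \<subseteq> T" "T \<subseteq> I" "finite T" for f T
    using M.finsum_support_superset that by blast
  show ?thesis
  proof (intro module_map.intro module_map_axioms.intro S M)
    show "finsum M f (?supp f) \<in> carrier M" if "f \<in> carrier ?S" for f
      by (rule M.finsum_closed) (use cl that in auto)
    show "finsum M (f \<oplus>\<^bsub>?S\<^esub> g) (?supp (f \<oplus>\<^bsub>?S\<^esub> g)) =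
        finsum M f (?supp f) \<oplus>\<^bsub>M\<^esub> finsum M g (?supp g)"
      if fg: "f \<in> carrier ?S" "g \<in> carrier ?S" for f g
    proof -
      \<comment> \<open>The support of the sum can be strictly smaller than this union, so all three
        sums are extended to it.\<close>
      let ?T = "?supp f \<union> ?supp g"
      have T: "finite ?T" "?T \<subseteq> I" using finI fg by auto
      have "finsum M (f \<oplus>\<^bsub>?S\<^esub> g) (?supp (f \<oplus>\<^bsub>?S\<^esub> g)) = finsum M (f \<oplus>\<^bsub>?S\<^esub> g) ?T"
        by (rule sum_eq) (use T cl fg in \<open>auto simp: ev\<close>)
      also have "\<dots> = finsum M (\<lambda>i. f i \<oplus>\<^bsub>M\<^esub> g i) ?T"
        by (rule M.finsum_cong') (use cl fg in \<open>auto simp: ev\<close>)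
      also have "\<dots> = finsum M f ?T \<oplus>\<^bsub>M\<^esub> finsum M g ?T"
        by (rule M.finsum_addf) (use cl fg in auto)
      also have "finsum M f ?T = finsum M f (?supp f)"
        by (rule sum_eq[symmetric]) (use T cl fg in auto)
      also have "finsum M g ?T = finsum M g (?supp g)"
        by (rule sum_eq[symmetric]) (use T cl fg in auto)
      finally show ?thesis .
    qed
    show "finsum M (a \<odot>\<^bsub>?S\<^esub> f) (?supp (a \<odot>\<^bsub>?S\<^esub> f)) = a \<odot>\<^bsub>M\<^esub> finsum M f (?supp f)"
      if a: "a \<in> carrier R" and f: "f \<in> carrier ?S" for a f
    proof -
      \<comment> \<open>Multiplication by \<open>a\<close> is linear because \<open>R\<close> is
        commutative, so \<open>map_finsum\<close> pulls \<open>a\<close> out of the sum.\<close>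
      have smult: "module_map R M M (\<lambda>m. a \<odot>\<^bsub>M\<^esub> m)"
        using a by (auto intro!: module_map.intro module_map_axioms.intro M M.smult_r_distr
          simp: M.R.m_comm simp flip: M.smult_assoc1)
      have "finsum M (a \<odot>\<^bsub>?S\<^esub> f) (?supp (a \<odot>\<^bsub>?S\<^esub> f)) = finsum M (a \<odot>\<^bsub>?S\<^esub> f) (?supp f)"
        by (rule sum_eq) (use finI cl f a in \<open>auto simp: ev\<close>)
      also have "\<dots> = finsum M (\<lambda>i. a \<odot>\<^bsub>M\<^esub> f i) (?supp f)"
        by (rule M.finsum_cong') (use cl f a in \<open>auto simp: ev\<close>)
      also have "\<dots> = a \<odot>\<^bsub>M\<^esub> finsum M f (?supp f)"
        by (rule module_map.map_finsum[OF smult, symmetric]) (use cl f in auto)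
      finally show ?thesis .
    qed
  qed
qed

section \<open>Fully faithful functors\<close>

text \<open>The category laws of \<open>A\<close> are not assumed: each law becomes a law of
  \<open>B\<close> after applying \<open>F\<close>, and faithfulness reflects it back. In
  particular, associativity in the skew category needs no computation with triple sums.\<close>

lemma faithful_linear_functorI:
  fixes A :: "('k, 'o, 'm, 'z) lincat_scheme" and B :: "('k, 'p, 'n, 'w) lincat_scheme"
  assumes B: "linear_category k B"
    and Hom: "\<And>x y. \<lbrakk>x \<in> Obj A; y \<in> Obj A\<rbrakk> \<Longrightarrow> module k (Hom A y x)"
    and Comp: "\<And>x y z f g. \<lbrakk>x \<in> Obj A; y \<in> Obj A; z \<in> Obj A;
        f \<in> carrier (Hom A y x); g \<in> carrier (Hom A z y)\<rbrakk>
        \<Longrightarrow> Comp A z y x g f \<in> carrier (Hom A z x)"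
    and Ident: "\<And>x. x \<in> Obj A \<Longrightarrow> Ident A x \<in> carrier (Hom A x x)"
    and FObj: "\<And>x. x \<in> Obj A \<Longrightarrow> FObj F x \<in> Obj B"
    and FMor: "\<And>x y. \<lbrakk>x \<in> Obj A; y \<in> Obj A\<rbrakk>
        \<Longrightarrow> module_map k (Hom A y x) (Hom B (FObj F y) (FObj F x)) (FMor F y x)"
    and faithful: "\<And>x y. \<lbrakk>x \<in> Obj A; y \<in> Obj A\<rbrakk> \<Longrightarrow> inj_on (FMor F y x) (carrier (Hom A y x))"
    and FMor_Comp: "\<And>x y z f g. \<lbrakk>x \<in> Obj A; y \<in> Obj A; z \<in> Obj A;
        f \<in> carrier (Hom A y x); g \<in> carrier (Hom A z y)\<rbrakk>
        \<Longrightarrow> FMor F z x (Comp A z y x g f) =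
            Comp B (FObj F z) (FObj F y) (FObj F x) (FMor F z y g) (FMor F y x f)"
    and FMor_Ident: "\<And>x. x \<in> Obj A \<Longrightarrow> FMor F x x (Ident A x) = Ident B (FObj F x)"
  shows "linear_functor k A B F"
proof -
  interpret B: linear_category k B by (rule B)
  note cl = module_map.map_closed[OF FMor] Comp Ident FObj
  note inj = inj_onD[OF faithful]
  note lin = module_map.map_add[OF FMor] module_map.map_smult[OF FMor]
    module_map.map_add[OF B.Comp_linear_left] module_map.map_smult[OF B.Comp_linear_left]
    module_map.map_add[OF B.Comp_linear_right] module_map.map_smult[OF B.Comp_linear_right]
  note add = abelian_groupE(1)[OF module.axioms(2)[OF Hom]]
  note smult = module.smult_closed[OF Hom]
  have "linear_category k A"
  proof (rule linear_category.intro, goal_cases)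
    case 1
    show ?case by (rule B.cring_k)
  next
    case (2 x y)
    then show ?case by (rule Hom)
  next
    case (3 x y z f)
    then show ?case
      by (intro module_map.intro module_map_axioms.intro Hom)
        (auto intro!: inj[of x z] simp: add smult cl lin FMor_Comp)
  next
    case (4 x y z g)
    then show ?case
      by (intro module_map.intro module_map_axioms.intro Hom)
        (auto intro!: inj[of x z] simp: add smult cl lin FMor_Comp)
  next
    case (5 w x y z f g h)
    then show ?case
      by (intro inj[of w z]) (auto simp: cl FMor_Comp B.Comp_assoc)
  next
    case (6 x)
    then show ?case by (rule Ident)
  next
    case (7 x y f)
    then show ?case
      by (intro inj[of x y]) (auto simp: cl FMor_Comp FMor_Ident B.Comp_Ident_left)
  next
    case (8 x y f)
    then show ?case
      by (intro inj[of x y]) (auto simp: cl FMor_Comp FMor_Ident B.Comp_Ident_right)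
  qed
  then show ?thesis
    by (intro linear_functor.intro linear_functor_axioms.intro B) (auto intro: assms)
qed

lemma (in linear_category) Comp_closed:
  "\<lbrakk>x \<in> Obj C; y \<in> Obj C; z \<in> Obj C; f \<in> carrier (Hom C y x); g \<in> carrier (Hom C z y)\<rbrakk>
    \<Longrightarrow> Comp C z y x g f \<in> carrier (Hom C z x)"
  using module_map.map_closed[OF Comp_linear_left] .

lemma (in linear_category) iso_morphism_Ident: "x \<in> Obj C \<Longrightarrow> iso_morphism C x x (Ident C x)"
  unfolding iso_morphism_def using Ident_closed Comp_Ident_left by blast

text \<open>The inverse functor is \<open>S\<close> on objects and the inverse bijections on
  morphisms. All its laws, and those of the unit, are checked after applying
  \<open>F\<close>.\<close>

lemma (in linear_functor) linearly_equivalent_section: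
  assumes bij: "\<And>x y. \<lbrakk>x \<in> Obj A; y \<in> Obj A\<rbrakk>
      \<Longrightarrow> bij_betw (FMor F y x) (carrier (Hom A y x)) (carrier (Hom B (FObj F y) (FObj F x)))"
    and S: "\<And>x. x \<in> Obj B \<Longrightarrow> S x \<in> Obj A" "\<And>x. x \<in> Obj B \<Longrightarrow> FObj F (S x) = x"
  shows "linearly_equivalent k A B"
proof -
  define lift where "lift y x = inv_into (carrier (Hom A y x)) (FMor F y x)" for y x
  have lift_closed: "lift y x f \<in> carrier (Hom A y x)"
    and FMor_lift: "FMor F y x (lift y x f) = f"
    if "x \<in> Obj A" "y \<in> Obj A" "f \<in> carrier (Hom B (FObj F y) (FObj F x))" for x y f
    using bij[of x y] that by (auto simp: bij_betw_def lift_def inv_into_into f_inv_into_f)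
  have faithful: "f = g" if "FMor F y x f = FMor F y x g" "x \<in> Obj A" "y \<in> Obj A"
    "f \<in> carrier (Hom A y x)" "g \<in> carrier (Hom A y x)" for x y f g
    using bij[of x y] that by (auto simp: bij_betw_def inj_on_def)
  note cl = FObj_closed lift_closed module_map.map_closed[OF FMor_linear] S
    A.Comp_closed A.Ident_closed B.Comp_closed B.Ident_closed
  define F' where "F' = \<lparr>FObj = S, FMor = (\<lambda>y x. lift (S y) (S x))\<rparr>"
  have F': "linear_functor k B A F'"
  proof (intro linear_functor.intro linear_functor_axioms.intro A.linear_category_axioms
      B.linear_category_axioms, goal_cases)
    case (2 x y)
    then show ?case
      using module_map.inv_into_module_map[OF FMor_linear bij, of "S x" "S y"]
      by (simp add: F'_def lift_def S)
  next
    case (3 x y z f g)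
    then show ?case
      by (intro faithful[of "S z" "S x"]) (auto simp: F'_def cl FMor_lift FMor_Comp)
  next
    case (4 x)
    then show ?case
      by (intro faithful[of "S x" "S x"]) (auto simp: F'_def cl FMor_lift FMor_Ident)
  qed (simp add: F'_def S)
  \<comment> \<open>The objects \<open>x\<close> and \<open>S (FObj F x)\<close> have the same image
    under \<open>F\<close>, so the identity of that image lifts to morphisms in both directions.
    Their composites lie over identities, hence are identities by faithfulness.\<close>
  define \<eta> where "\<eta> x = lift x (S (FObj F x)) (Ident B (FObj F x))" for x
  define \<theta> where "\<theta> x = lift (S (FObj F x)) x (Ident B (FObj F x))" for x
  have "natural_iso A A (comp_functor F' F) id_functor \<eta>"
    unfolding natural_iso_def
  proof (intro conjI ballI)
    fix x assume x: "x \<in> Obj A"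
    let ?x = "S (FObj F x)"
    have "Comp A ?x x ?x (\<theta> x) (\<eta> x) = Ident A ?x"
      by (rule faithful[of ?x ?x])
        (auto simp: \<eta>_def \<theta>_def x cl FMor_Comp FMor_lift FMor_Ident B.Comp_Ident_left)
    moreover have "Comp A x ?x x (\<eta> x) (\<theta> x) = Ident A x"
      by (rule faithful[of x x])
        (auto simp: \<eta>_def \<theta>_def x cl FMor_Comp FMor_lift FMor_Ident B.Comp_Ident_left)
    moreover have "\<eta> x \<in> carrier (Hom A x ?x)" "\<theta> x \<in> carrier (Hom A ?x x)"
      by (auto simp: \<eta>_def \<theta>_def x cl)
    ultimately show "iso_morphism A (FObj id_functor x) (FObj (comp_functor F' F) x) (\<eta> x)"
      by (auto simp: iso_morphism_def id_functor_def comp_functor_def F'_def)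
  next
    fix x y f assume xy: "x \<in> Obj A" "y \<in> Obj A" and f: "f \<in> carrier (Hom A y x)"
    \<comment> \<open>Under \<open>F\<close> both sides of the naturality square become
      \<open>FMor F y x f\<close>.\<close>
    have "Comp A y (S (FObj F y)) (S (FObj F x)) (\<eta> y)
        (lift (S (FObj F y)) (S (FObj F x)) (FMor F y x f)) =
      Comp A y x (S (FObj F x)) f (\<eta> x)"
      by (rule faithful[of y "S (FObj F x)"])
        (use xy f in \<open>auto simp: \<eta>_def cl FMor_Comp FMor_lift B.Comp_Ident_left B.Comp_Ident_right\<close>)
    then show "Comp A (FObj id_functor y) (FObj (comp_functor F' F) y) (FObj (comp_functor F' F) x)
        (\<eta> y) (FMor (comp_functor F' F) y x f) =
      Comp A (FObj id_functor y) (FObj id_functor x) (FObj (comp_functor F' F) x)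
        (FMor id_functor y x f) (\<eta> x)"
      by (simp add: id_functor_def comp_functor_def F'_def)
  qed
  \<comment> \<open>Since \<open>S\<close> is a strict section, going to \<open>A\<close> and back
    fixes objects and morphisms of \<open>B\<close>, and identities serve as the counit.\<close>
  moreover have "natural_iso B B (comp_functor F F') id_functor (Ident B)"
    unfolding natural_iso_def id_functor_def comp_functor_def F'_def
    by (auto simp: S B.iso_morphism_Ident FMor_lift B.Comp_Ident_left B.Comp_Ident_right)
  ultimately show ?thesis
    unfolding linearly_equivalent_def using linear_functor_axioms F' by blast
qed

section \<open>The skew category of the smash product\<close>

context graded_category
begin

text \<open>On morphisms this is the summation map occurring in \<open>internal_direct_sum\<close>,
  which makes the grading hypothesis directly applicable.\<close>

definition forget_degree :: "('o \<times> 'g, 'g \<Rightarrow> 'm, 'o, 'm) cfunctor" where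
  "forget_degree = \<lparr>FObj = fst, FMor = (\<lambda>y x f. finsum (Hom B (fst y) (fst x)) f
     {u \<in> carrier G. f u \<noteq> \<zero>\<^bsub>Hom B (fst y) (fst x)\<^esub>})\<rparr>"

lemma FObj_forget_degree: "FObj forget_degree = fst"
  by (simp add: forget_degree_def)

text \<open>The value at \<open>u\<close> is the degree in \<open>B\<close> of the component indexed
  by \<open>u\<close> of a skew morphism from \<open>(x, s)\<close> to
  \<open>(y, t)\<close>.\<close>

lemma bij_betw_shift:
  assumes "s \<in> carrier G" "t \<in> carrier G"
  shows "bij_betw (\<lambda>u. inv t \<otimes> (u \<otimes> s)) (carrier G) (carrier G)"
proof -
  have "t \<otimes> (inv t \<otimes> a) = a" "inv t \<otimes> (t \<otimes> a) = a" if "a \<in> carrier G" for a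
    using assms that by (simp_all flip: m_assoc)
  then show ?thesis
    by (intro bij_betw_byWitness[where f' = "\<lambda>v. t \<otimes> (v \<otimes> inv s)"])
      (use assms in \<open>auto simp: m_assoc\<close>)
qed

lemma Obj_skew_smash: "Obj (skew_category G (smash_product G B)) = Obj B \<times> carrier G"
  by (simp add: skew_category_def smash_product_def)

lemma Hom_skew_smash:
  assumes "x \<in> Obj B" "s \<in> carrier G"
  shows "Hom (skew_category G (smash_product G B)) (y, t) (x, s) =
    module_sum (carrier G) (\<lambda>u. (Hom B y x)\<lparr>carrier := Deg B y x (inv t \<otimes> (u \<otimes> s))\<rparr>)"
  using assms by (auto simp: skew_category_def smash_product_def intro: module_sum_cong)

lemma Deg_shift_direct_sum:
  assumes "x \<in> Obj B" "y \<in> Obj B" "s \<in> carrier G" "t \<in> carrier G"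
  shows "internal_direct_sum k (Hom B y x) (carrier G) (\<lambda>u. Deg B y x (inv t \<otimes> (u \<otimes> s)))"
  by (rule internal_direct_sum_reindex[OF Hom_module Deg_direct_sum bij_betw_shift]) fact+

text \<open>Both claims rest on the same description of the composite: its component at
  \<open>u\<close> is the sum \<open>d u\<close> of all \<open>Comp B z y x (g p) (f q)\<close> with
  \<open>p \<otimes> q = u\<close>. Summing over \<open>u\<close> then gives the composite of the
  two totals by bilinearity.\<close>

lemma Comp_skew_smash:
  assumes obj: "x \<in> Obj B" "y \<in> Obj B" "z \<in> Obj B" "s \<in> carrier G" "t \<in> carrier G" "w \<in> carrier G"
    and f: "f \<in> carrier (Hom (skew_category G (smash_product G B)) (y, t) (x, s))"
    and g: "g \<in> carrier (Hom (skew_category G (smash_product G B)) (z, w) (y, t))"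
  defines "fg \<equiv> Comp (skew_category G (smash_product G B)) (z, w) (y, t) (x, s) g f"
  shows "fg \<in> carrier (Hom (skew_category G (smash_product G B)) (z, w) (x, s))"
    and "FMor forget_degree (z, w) (x, s) fg =
      Comp B z y x (FMor forget_degree (z, w) (y, t) g) (FMor forget_degree (y, t) (x, s) f)"
proof -
  interpret zx: module k "Hom B z x" using Hom_module obj by simp
  interpret zy: module k "Hom B z y" using Hom_module obj by simp
  interpret yx: module k "Hom B y x" using Hom_module obj by simp
  let ?D = "\<lambda>u. Deg B z x (inv w \<otimes> (u \<otimes> s))"
  define supp_f where "supp_f = {q \<in> carrier G. f q \<noteq> \<zero>\<^bsub>Hom B y x\<^esub>}"
  define supp_g where "supp_g = {p \<in> carrier G. g p \<noteq> \<zero>\<^bsub>Hom B z y\<^esub>}"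
  define P where "P = supp_g \<times> supp_f"
  define mul where "mul = (\<lambda>(p, q). p \<otimes> q)"
  define c where "c = (\<lambda>(p, q). Comp B z y x (g p) (f q))"
  \<comment> \<open>A finite set of indices outside which the composite vanishes; it may exceed the
    support, as terms can cancel.\<close>
  define T where "T = mul ` P"
  have f_Deg: "f q \<in> Deg B y x (inv t \<otimes> (q \<otimes> s))" if "q \<in> carrier G" for q
    using f that by (auto simp: Hom_skew_smash obj module_sum_def)
  have g_Deg: "g p \<in> Deg B z y (inv w \<otimes> (p \<otimes> t))" if "p \<in> carrier G" for p
    using g that by (auto simp: Hom_skew_smash obj module_sum_def)
  have f_cl: "f q \<in> carrier (Hom B y x)" if "q \<in> carrier G" for q
    using f_Deg[OF that] Deg_subset[of x y "inv t \<otimes> (q \<otimes> s)"] obj that by auto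
  have g_cl: "g p \<in> carrier (Hom B z y)" if "p \<in> carrier G" for p
    using g_Deg[OF that] Deg_subset[of y z "inv w \<otimes> (p \<otimes> t)"] obj that by auto
  have fin: "finite supp_f" "finite supp_g"
    using f g by (auto simp: Hom_skew_smash obj module_sum_def supp_f_def supp_g_def)
  have PG: "P \<subseteq> carrier G \<times> carrier G" "T \<subseteq> carrier G" "finite P" "finite T"
    using fin by (auto simp: P_def supp_f_def supp_g_def T_def mul_def)
  \<comment> \<open>The inner \<open>t\<close> and its inverse cancel in the product of degrees,
    leaving the degree that the component at \<open>p \<otimes> q\<close> must have.\<close>
  have c_Deg: "c (p, q) \<in> ?D (p \<otimes> q)" if "p \<in> carrier G" "q \<in> carrier G" for p q
  proof -
    have "t \<otimes> (inv t \<otimes> (q \<otimes> s)) = q \<otimes> s"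
      using that obj by (simp flip: m_assoc)
    then have "inv w \<otimes> (p \<otimes> t) \<otimes> (inv t \<otimes> (q \<otimes> s)) = inv w \<otimes> (p \<otimes> q \<otimes> s)"
      using that obj by (simp add: m_assoc)
    then show ?thesis
      using that obj Deg_Comp[OF _ _ _ _ _ f_Deg g_Deg, of q p] by (simp add: c_def)
  qed
  have c_cl: "c \<in> P \<rightarrow> carrier (Hom B z x)"
  proof
    fix r assume r: "r \<in> P"
    obtain p q where pq: "r = (p, q)" "p \<in> carrier G" "q \<in> carrier G"
      using PG(1) r by auto
    then show "c r \<in> carrier (Hom B z x)"
      using c_Deg[OF pq(2,3)] Deg_subset[of x z "inv w \<otimes> (p \<otimes> q \<otimes> s)"] obj by auto
  qed
  define d where "d u = finsum (Hom B z x) c {r \<in> P. mul r = u}" for u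
  have sub: "module_map k ((Hom B z x)\<lparr>carrier := ?D u\<rparr>) (Hom B z x) (\<lambda>f. f)"
    if "u \<in> carrier G" for u
    by (rule submodule_inclusion) (use that obj in \<open>auto intro: Hom_module Deg_submodule\<close>)
  have c_fib: "c \<in> {r \<in> P. mul r = u} \<rightarrow> ?D u" for u
    using PG(1) c_Deg by (auto simp: mul_def)
  \<comment> \<open>The skew composition sums inside a homogeneous component, whereas
    \<open>d\<close> sums in the whole morphism module of \<open>B\<close>.\<close>
  have d_eq: "finsum ((Hom B z x)\<lparr>carrier := ?D u\<rparr>) c {r \<in> P. mul r = u} = d u"
    if "u \<in> carrier G" for u
    using module_map.map_finsum[OF sub[OF that], of c] c_fib by (simp add: d_def)
  have d_Deg: "d u \<in> ?D u" if "u \<in> carrier G" for u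
  proof -
    interpret D: module k "(Hom B z x)\<lparr>carrier := ?D u\<rparr>"
      using sub[OF that] by (simp add: module_map_def)
    show ?thesis
      using D.finsum_closed[of c "{r \<in> P. mul r = u}"] c_fib d_eq[OF that] by simp
  qed
  have d_supp: "u \<in> T" if "d u \<noteq> \<zero>\<^bsub>Hom B z x\<^esub>" for u
  proof (rule ccontr)
    assume "u \<notin> T"
    then have "{r \<in> P. mul r = u} = {}" by (auto simp: T_def)
    then have "d u = \<zero>\<^bsub>Hom B z x\<^esub>"
      unfolding d_def by (simp only: zx.M.finsum_empty)
    then show False using that by simp
  qed
  \<comment> \<open>Translation acts as the identity on underlying morphisms, so the twist by
    \<open>t\<close> in the skew composition disappears.\<close>
  have fg: "fg = restrict d (carrier G)"
  proof -
    have "{(p, q). p \<in> carrier G \<and> q \<in> carrier G \<and> p \<otimes> q = u \<and>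
        g p \<noteq> \<zero>\<^bsub>Hom B z y\<^esub> \<and> f q \<noteq> \<zero>\<^bsub>Hom B y x\<^esub>} = {r \<in> P. mul r = u}" for u
      by (auto simp: P_def supp_f_def supp_g_def mul_def)
    moreover have "fg = (\<lambda>u\<in>carrier G. finsum ((Hom B z x)\<lparr>carrier := ?D u\<rparr>) c
      {(p, q). p \<in> carrier G \<and> q \<in> carrier G \<and> p \<otimes> q = u \<and>
        g p \<noteq> \<zero>\<^bsub>Hom B z y\<^esub> \<and> f q \<noteq> \<zero>\<^bsub>Hom B y x\<^esub>})"
      unfolding fg_def skew_category_def smash_product_def c_def
      using obj by (simp add: cong: conj_cong restrict_cong)
    ultimately show ?thesis
      using d_eq by (simp cong: restrict_cong)
  qed
  have fin_d: "finite {u \<in> carrier G. d u \<noteq> \<zero>\<^bsub>Hom B z x\<^esub>}"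
    by (rule finite_subset[OF _ PG(4)]) (use d_supp in auto)
  then show "fg \<in> carrier (Hom (skew_category G (smash_product G B)) (z, w) (x, s))"
    using d_Deg by (auto simp: Hom_skew_smash obj module_sum_def fg cong: conj_cong)
  have d_cl: "d \<in> carrier G \<rightarrow> carrier (Hom B z x)"
    using c_cl by (auto simp: d_def intro!: zx.M.finsum_closed)
  have "FMor forget_degree (z, w) (x, s) fg =
      finsum (Hom B z x) d {u \<in> carrier G. d u \<noteq> \<zero>\<^bsub>Hom B z x\<^esub>}"
    unfolding forget_degree_def fg using d_cl
    by (auto intro!: zx.M.finsum_cong')
  also have "\<dots> = finsum (Hom B z x) d T"
    by (rule zx.M.finsum_support_superset) (use PG d_supp d_cl in auto)
  also have "\<dots> = finsum (Hom B z x) c P"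
    unfolding d_def by (rule zx.M.finsum_fibres) (use PG c_cl in \<open>auto simp: T_def\<close>)
  also have "\<dots> = finsum (Hom B z x) (\<lambda>p. finsum (Hom B z x) (\<lambda>q. c (p, q)) supp_f) supp_g"
    unfolding P_def by (rule zx.M.finsum_Times) (use fin c_cl in \<open>auto simp: P_def\<close>)
  \<comment> \<open>Linearity in the right factor collects the sum over \<open>q\<close>; linearity
    in the left factor then collects the sum over \<open>p\<close>.\<close>
  also have "\<dots> = finsum (Hom B z x)
      (\<lambda>p. Comp B z y x (g p) (finsum (Hom B y x) f supp_f)) supp_g"
  proof (rule zx.M.finsum_cong'[OF refl])
    have "finsum (Hom B y x) f supp_f \<in> carrier (Hom B y x)"
      by (rule yx.M.finsum_closed) (auto simp: supp_f_def f_cl)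
    then show "(\<lambda>p. Comp B z y x (g p) (finsum (Hom B y x) f supp_f)) \<in> supp_g \<rightarrow> carrier (Hom B z x)"
      using obj g_cl by (auto simp: supp_g_def intro!: Comp_closed)
    show "finsum (Hom B z x) (\<lambda>q. c (p, q)) supp_f =
        Comp B z y x (g p) (finsum (Hom B y x) f supp_f)" if "p \<in> supp_g" for p
      using module_map.map_finsum[OF Comp_linear_right, of x y z "g p" f supp_f] that obj g_cl f_cl
      by (auto simp: c_def supp_f_def supp_g_def)
  qed
  also have "\<dots> = Comp B z y x (finsum (Hom B z y) g supp_g) (finsum (Hom B y x) f supp_f)"
  proof -
    have "finsum (Hom B y x) f supp_f \<in> carrier (Hom B y x)"
      by (rule yx.M.finsum_closed) (auto simp: supp_f_def f_cl)
    then show ?thesis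
      using module_map.map_finsum[OF Comp_linear_left, of x y z _ g supp_g] obj g_cl
      by (auto simp: supp_g_def)
  qed
  finally show "FMor forget_degree (z, w) (x, s) fg =
      Comp B z y x (FMor forget_degree (z, w) (y, t) g) (FMor forget_degree (y, t) (x, s) f)"
    by (simp add: forget_degree_def supp_f_def supp_g_def)
qed

text \<open>At the index \<open>\<one>\<close> the required degree
  \<open>inv s \<otimes> (\<one> \<otimes> s)\<close> is \<open>\<one>\<close>, the degree of
  \<open>Ident B x\<close>; every other component is zero.\<close>

lemma Ident_skew_smash:
  assumes obj: "x \<in> Obj B" "s \<in> carrier G"
  defines "e \<equiv> Ident (skew_category G (smash_product G B)) (x, s)"
  shows "e \<in> carrier (Hom (skew_category G (smash_product G B)) (x, s) (x, s))"
    and "FMor forget_degree (x, s) (x, s) e = Ident B x"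
proof -
  interpret xx: module k "Hom B x x" using Hom_module obj by simp
  have e: "e = (\<lambda>u\<in>carrier G. if u = \<one> then Ident B x else \<zero>\<^bsub>Hom B x x\<^esub>)"
    using obj by (auto simp: e_def skew_category_def smash_product_def)
  have zero: "\<zero>\<^bsub>Hom B x x\<^esub> \<in> Deg B x x u" if "u \<in> carrier G" for u
    using subgroup.one_closed[OF submodule.axioms(1)[OF Deg_submodule[OF obj(1) obj(1) that]]] by simp
  \<comment> \<open>Only an inclusion holds in general, since \<open>Ident B x\<close> may itself be
    zero.\<close>
  have supp: "{u \<in> carrier G. e u \<noteq> \<zero>\<^bsub>Hom B x x\<^esub>} \<subseteq> {\<one>}"
    by (auto simp: e split: if_splits)
  then have "finite {u \<in> carrier G. e u \<noteq> \<zero>\<^bsub>Hom B x x\<^esub>}"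
    by (rule finite_subset) simp
  moreover have "e \<in> (\<Pi>\<^sub>E u\<in>carrier G. Deg B x x (inv s \<otimes> (u \<otimes> s)))"
    using obj zero by (auto simp: e Deg_Ident)
  ultimately show "e \<in> carrier (Hom (skew_category G (smash_product G B)) (x, s) (x, s))"
    by (simp add: Hom_skew_smash obj module_sum_def)
  have e_cl: "e \<in> carrier G \<rightarrow> carrier (Hom B x x)"
    using obj by (auto simp: e Ident_closed)
  have "FMor forget_degree (x, s) (x, s) e = finsum (Hom B x x) e {\<one>}"
    unfolding forget_degree_def using xx.M.finsum_support_superset[OF _ supp _ e_cl] by simp
  also have "\<dots> = Ident B x"
    using obj by (simp add: e Ident_closed xx.M.finsum_insert)
  finally show "FMor forget_degree (x, s) (x, s) e = Ident B x" .
qed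

end

theorem corollary3p3:
  fixes k :: "('k, 'r) ring_scheme"
    and G :: "('g, 'h) monoid_scheme"
    and B :: "('k, 'o, 'm, 'g) graded_lincat"
  assumes "cring k" and "group G" and "graded_category k G B"
  shows "linearly_equivalent k (skew_category G (smash_product G B)) B"
proof -
  interpret graded_category k G B by (rule assms(3))
  let ?K = "skew_category G (smash_product G B)"
  \<comment> \<open>Once the morphism modules are rewritten by \<open>Hom_skew_smash\<close>, the
    functor is the summation map for the shifted grading, so linearity and bijectivity can be read
    off.\<close>
  have sum: "module_map k (Hom ?K y x) (Hom B (fst y) (fst x)) (FMor forget_degree y x)"
    and bij: "bij_betw (FMor forget_degree y x) (carrier (Hom ?K y x)) (carrier (Hom B (fst y) (fst x)))"
    if "x \<in> Obj ?K" "y \<in> Obj ?K" for x y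
    using that internal_direct_sum_module_map[OF Hom_module Deg_shift_direct_sum, of "fst x" "fst y" "snd x" "snd y"]
      Deg_shift_direct_sum[of "fst x" "fst y" "snd x" "snd y"]
    by (auto simp: Obj_skew_smash Hom_skew_smash forget_degree_def internal_direct_sum_def)
  have F: "linear_functor k ?K B forget_degree"
  proof (rule faithful_linear_functorI)
    show "linear_category k B" by unfold_locales
    show "module k (Hom ?K y x)" if "x \<in> Obj ?K" "y \<in> Obj ?K" for x y
      using sum[OF that] by (simp add: module_map_def)
    show "inj_on (FMor forget_degree y x) (carrier (Hom ?K y x))"
      if "x \<in> Obj ?K" "y \<in> Obj ?K" for x y
      using bij[OF that] by (simp add: bij_betw_def)
  qed (auto simp: Obj_skew_smash Comp_skew_smash Ident_skew_smash FObj_forget_degree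
      intro: sum)
  \<comment> \<open>Pairing each object with the unit of \<open>G\<close> gives a section of
    \<open>fst\<close>.\<close>
  show ?thesis
    by (rule linear_functor.linearly_equivalent_section[OF F, where S = "\<lambda>x. (x, \<one>\<^bsub>G\<^esub>)"])
      (use bij in \<open>auto simp: Obj_skew_smash FObj_forget_degree\<close>)
qed

end
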